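(* The generating function $G^{(2)}_{n}(r)=G^{(2)}_{n}(m,r,s)$ of dimer configurations on the segment $[0,n]$ satisfying (C1), (C2) and (C3) satisfies, for $n\ge 2$, the recurrence relation $$G^{(2)}_{n}(r)=(1+rs(m-2))G^{(2)}_{n-1}(rs)+rs\,G^{(2)}_{n-2}(rs^2)+rs(1+rs^2(m-1))G^{(2)}_{n-3}(rs^3)+r^2s^3G^{(2)}_{n-4}(rs^{4}),$$ with the initial conditions $G^{(2)}_{i}(m,r,s)=1$ for $i\le 0$ and $G^{(2)}_{1}(m,r,s)=1+rsm$.
   Context: Let $v_0,\dots,v_n$ be the vertices of the segment $[0,n]$. A dimer at position $i$ ($1\le i\le n$) is an edge connecting $v_{i-1}$ and $v_i$; each dimer carries one of $m$ colors. The conditions on a configuration are: (C1) there is at most one dimer at each position $i$; (C2) two dimers at adjacent positions $i,i+1$ have different colors; (C3) two dimers with the same color have distance at least two, where the distance between dimers at positions $i<j$ is $j-i-1$, the number of positions strictly between them (so dimers of the same color are at positions differing by at least $3$). $G^{(2)}_n(m,r,s)$ is the sum, over all colored configurations, of $r^{b}s^{c}$, where $b$ is the number of dimers and $c$ is the sum of the positions of the dimers. By convention $G^{(2)}_i=1$ for $i\le 0$. The notation $G^{(2)}_{i}(rs^p)$ means $G^{(2)}_i(m,rs^p,s)$. *)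

theory Defs
  imports Main
begin

text \<open>
  A dimer is a pair of its position and its color, the colors being \<open>0, \<dots>, m - 1\<close>.
  As (C1) rules out repeated dimers anyway, a configuration is a set of dimers.
\<close>

type_synonym dimer = "nat \<times> nat"

definition C1 :: "dimer set \<Rightarrow> bool" where
  "C1 D \<longleftrightarrow> (\<forall>i a b. (i, a) \<in> D \<and> (i, b) \<in> D \<longrightarrow> a = b)"

definition C2 :: "dimer set \<Rightarrow> bool" where
  "C2 D \<longleftrightarrow> (\<forall>i a b. (i, a) \<in> D \<and> (i + 1, b) \<in> D \<longrightarrow> a \<noteq> b)"

text \<open>The distance of dimers at positions \<open>i < j\<close> is the number of positions strictly between.\<close>

definition C3 :: "dimer set \<Rightarrow> bool" where
  "C3 D \<longleftrightarrow> (\<forall>i j a. (i, a) \<in> D \<and> (j, a) \<in> D \<and> i < j \<longrightarrow> 2 \<le> j - i - 1)"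

text \<open>
  The index \<open>n\<close> is an integer, since the recurrence refers to negative indices.
  For \<open>n \<le> 0\<close> there are no positions, so that only the empty configuration remains and the
  convention that the generating function is \<open>1\<close> for such \<open>n\<close> holds automatically.
\<close>

definition configs :: "nat \<Rightarrow> int \<Rightarrow> dimer set set" where
  "configs m n = {D. D \<subseteq> {1..nat n} \<times> {..<m} \<and> C1 D \<and> C2 D \<and> C3 D}"

text \<open>
  The variables \<open>r\<close> and \<open>s\<close> range over an arbitrary commutative ring; formal variables are the
  special case of a polynomial ring.
\<close>

definition G2 :: "int \<Rightarrow> nat \<Rightarrow> 'a::comm_ring_1 \<Rightarrow> 'a \<Rightarrow> 'a" where
  "G2 n m r s = (\<Sum>D\<in>configs m n. r ^ card D * s ^ (\<Sum>d\<in>D. fst d))"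

end

theory Submission
  imports Defs
begin

text \<open>
  Scan the segment from the left. What the dimers already placed say about the rest of the segment
  is which colors they forbid at its first and at its second position, and up to the choice of
  colors there are four such states. Removing the first position replaces \<open>r\<close> by \<open>r s\<close> and gives a
  linear system for the generating functions of the four states; eliminating three of them
  yields the recurrence of order four.
\<close>

section \<open>The conditions as one condition on pairs of dimers\<close>

definition valid :: "dimer set \<Rightarrow> bool" where
  "valid D \<longleftrightarrow> (\<forall>i a j b. (i, a) \<in> D \<longrightarrow> (j, b) \<in> D \<longrightarrow>
     (i = j \<longrightarrow> a = b) \<and> (i < j \<and> j \<le> i + 2 \<longrightarrow> a \<noteq> b))"

text \<open>Distance at least two means positions differing by at least 3. So a dimer constrains
  only its own position and the next two, which keeps the state of the scan small.\<close>

lemma valid_iff: "valid D \<longleftrightarrow> C1 D \<and> C2 D \<and> C3 D"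
proof
  assume v: "valid D"
  have "C1 D" using v unfolding valid_def C1_def by blast
  moreover have "C2 D" unfolding C2_def
  proof (intro allI impI)
    fix i a b assume "(i, a) \<in> D \<and> (i + 1, b) \<in> D"
    moreover have "i < i + 1 \<and> i + 1 \<le> i + 2" by simp
    ultimately show "a \<noteq> b" using v unfolding valid_def by blast
  qed
  moreover have "C3 D" unfolding C3_def
  proof (intro allI impI)
    fix i j a assume "(i, a) \<in> D \<and> (j, a) \<in> D \<and> i < j"
    then have "\<not> j \<le> i + 2" using v unfolding valid_def by blast
    then show "2 \<le> j - i - 1" by linarith
  qed
  ultimately show "C1 D \<and> C2 D \<and> C3 D" by blast
next
  assume c: "C1 D \<and> C2 D \<and> C3 D"
  show "valid D" unfolding valid_def
  proof (intro allI impI conjI)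
    fix i a j b assume d: "(i, a) \<in> D" "(j, b) \<in> D"
    show "a = b" if "i = j" using c d that unfolding C1_def by blast
    show "a \<noteq> b" if ij: "i < j \<and> j \<le> i + 2"
    proof
      assume "a = b"
      then have "2 \<le> j - i - 1" using c d ij unfolding C3_def by blast
      with ij show False by linarith
    qed
  qed
qed

section \<open>Moving a configuration one position to the right\<close>

definition shift :: "dimer set \<Rightarrow> dimer set" where
  "shift D = map_prod Suc id ` D"

lemma mem_shift [simp]: "(i, a) \<in> shift D \<longleftrightarrow> (\<exists>j. i = Suc j \<and> (j, a) \<in> D)"
  by (force simp: shift_def)

lemma shift_inject: "shift D = shift E \<longleftrightarrow> D = E"
  unfolding shift_def by (intro inj_image_eq_iff) (simp add: prod.inj_map)

lemma valid_shift: "valid (shift D) \<longleftrightarrow> valid D"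
proof
  assume v: "valid (shift D)"
  show "valid D" unfolding valid_def
  proof (intro allI impI)
    fix i a j b assume "(i, a) \<in> D" "(j, b) \<in> D"
    then have "(Suc i, a) \<in> shift D" "(Suc j, b) \<in> shift D" by auto
    then have "(Suc i = Suc j \<longrightarrow> a = b) \<and> (Suc i < Suc j \<and> Suc j \<le> Suc i + 2 \<longrightarrow> a \<noteq> b)"
      using v unfolding valid_def by blast
    then show "(i = j \<longrightarrow> a = b) \<and> (i < j \<and> j \<le> i + 2 \<longrightarrow> a \<noteq> b)" by simp
  qed
qed (auto simp: valid_def)

text \<open>A dimer at position 1 can conflict in color only with positions 2 and 3 of
  \<open>shift D\<close>, which are positions 1 and 2 of \<open>D\<close>. The assumption keeps
  position 1 of \<open>shift D\<close> free.\<close>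

lemma valid_insert_shift:
  assumes "\<And>b. (0, b) \<notin> D"
  shows "valid (insert (1, a) (shift D)) \<longleftrightarrow> valid D \<and> (1, a) \<notin> D \<and> (2, a) \<notin> D"
proof
  assume v: "valid (insert (1, a) (shift D))"
  then have "valid (shift D)" unfolding valid_def by blast
  moreover have "(i, a) \<notin> D" if i: "i = 1 \<or> i = 2" for i
  proof
    assume "(i, a) \<in> D"
    then have "(Suc i, a) \<in> insert (1, a) (shift D)" by simp
    moreover have "(1, a) \<in> insert (1, a) (shift D)" by simp
    moreover have "1 < Suc i \<and> Suc i \<le> 1 + 2" using i by auto
    ultimately show False using v unfolding valid_def by blast
  qed
  ultimately show "valid D \<and> (1, a) \<notin> D \<and> (2, a) \<notin> D" by (simp add: valid_shift)
next
  assume v: "valid D \<and> (1, a) \<notin> D \<and> (2, a) \<notin> D"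
  have first: "b \<noteq> a" if "(i, b) \<in> D" "i \<le> 2" for i b
  proof -
    have "i \<noteq> 0" using assms that(1) by (cases i) auto
    then have "i = 1 \<or> i = 2" using that by linarith
    then show ?thesis using v that by auto
  qed
  have pos: "i > 0" if "(i, b) \<in> D" for i b
    using assms that by (cases i) auto
  have "valid (shift D)" using v by (simp add: valid_shift)
  then show "valid (insert (1, a) (shift D))"
    unfolding valid_def
  proof (intro allI impI)
    fix i b j c
    assume vs: "\<forall>i a j b. (i, a) \<in> shift D \<longrightarrow> (j, b) \<in> shift D \<longrightarrow>
        (i = j \<longrightarrow> a = b) \<and> (i < j \<and> j \<le> i + 2 \<longrightarrow> a \<noteq> b)"
      and b: "(i, b) \<in> insert (1, a) (shift D)" and c: "(j, c) \<in> insert (1, a) (shift D)"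
    \<comment> \<open>Dimers of \<open>shift D\<close> lie to the right of the new one, and those
      within its reach (positions up to 3) differ from it in color by \<open>first\<close>.\<close>
    have late: "k > 1" if "(k, d) \<in> shift D" for k d using that pos by auto
    have near: "d \<noteq> a" if "(k, d) \<in> shift D" "k \<le> 3" for k d
      using that first[of "k - 1" d] by auto
    from b c consider "(i, b) = (1, a)" "(j, c) = (1, a)"
      | "(i, b) = (1, a)" "(j, c) \<in> shift D"
      | "(i, b) \<in> shift D" "(j, c) = (1, a)"
      | "(i, b) \<in> shift D" "(j, c) \<in> shift D" by blast
    then show "(i = j \<longrightarrow> b = c) \<and> (i < j \<and> j \<le> i + 2 \<longrightarrow> b \<noteq> c)"
    proof cases
      case 2
      then show ?thesis using late[of j c] near[of j c] by auto
    next
      case 3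
      then show ?thesis using late[of i b] by auto
    next
      case 4
      then show ?thesis using vs by blast
    qed simp
  qed
qed

section \<open>Configurations with forbidden colors\<close>

definition dimers :: "nat \<Rightarrow> nat \<Rightarrow> dimer set" where
  "dimers m n = {1..n} \<times> {..<m}"

text \<open>\<open>X\<close> and \<open>Y\<close> are the colors forbidden at the first and at the second position.\<close>

definition restricted :: "nat \<Rightarrow> nat \<Rightarrow> nat set \<Rightarrow> nat set \<Rightarrow> dimer set set" where
  "restricted m n X Y = {D. D \<subseteq> dimers m n \<and> valid D \<and>
     (\<forall>a\<in>X. (1, a) \<notin> D) \<and> (\<forall>a\<in>Y. (2, a) \<notin> D)}"

lemma finite_dimers: "finite (dimers m n)"
  by (simp add: dimers_def)

lemma finite_restricted: "finite (restricted m n X Y)"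
  by (rule finite_subset[of _ "Pow (dimers m n)"]) (auto simp: restricted_def finite_dimers)

lemma restricted_finite: "D \<in> restricted m n X Y \<Longrightarrow> finite D"
  using finite_subset[OF _ finite_dimers] by (auto simp: restricted_def)

lemma shift_subset_dimers:
  assumes "\<And>b. (0, b) \<notin> D"
  shows "shift D \<subseteq> dimers m (Suc n) \<longleftrightarrow> D \<subseteq> dimers m n"
proof
  assume s: "shift D \<subseteq> dimers m (Suc n)"
  show "D \<subseteq> dimers m n"
  proof clarify
    fix i a assume d: "(i, a) \<in> D"
    then have "(Suc i, a) \<in> dimers m (Suc n)" using s by auto
    moreover have "i \<noteq> 0" using d assms by (cases i) auto
    ultimately show "(i, a) \<in> dimers m n" by (auto simp: dimers_def)
  qed
qed (fastforce simp: dimers_def)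

text \<open>With position 1 empty, \<open>X\<close> holds vacuously, and the second position of the
  segment becomes the first of the rest, so \<open>Y\<close> takes the place of
  \<open>X\<close>.\<close>

lemma shift_mem_restricted:
  assumes "\<And>b. (0, b) \<notin> D"
  shows "shift D \<in> restricted m (Suc n) X Y \<longleftrightarrow> D \<in> restricted m n Y {}"
  using assms
  by (auto simp: restricted_def shift_subset_dimers valid_shift numeral_2_eq_2)

text \<open>The new dimer forbids its color at the next two positions: \<open>a\<close> joins the
  inherited \<open>Y\<close> at the first position of the rest and stands alone at the
  second.\<close>

lemma insert_shift_mem_restricted:
  assumes "\<And>b. (0, b) \<notin> D"
  shows "insert (1, a) (shift D) \<in> restricted m (Suc n) X Y \<longleftrightarrow>
    a \<in> {..<m} - X \<and> D \<in> restricted m n (insert a Y) {a}"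
proof -
  have "(1, a) \<in> dimers m (Suc n) \<longleftrightarrow> a < m" by (auto simp: dimers_def)
  moreover have "(2, b) \<in> insert (1, a) (shift D) \<longleftrightarrow> (1, b) \<in> D" for b
    by (auto simp: numeral_2_eq_2)
  moreover have "(1, b) \<in> insert (1, a) (shift D) \<longleftrightarrow> b = a" for b
    using assms by auto
  ultimately show ?thesis
    unfolding restricted_def mem_Collect_eq valid_insert_shift[OF assms] insert_subset
      shift_subset_dimers[OF assms] by auto
qed

lemma restricted_no_0: "D \<in> restricted m n X Y \<Longrightarrow> (0, b) \<notin> D"
  by (auto simp: restricted_def dimers_def)

text \<open>Case split on position 1: empty, or holding a dimer of some allowed color
  \<open>a\<close>.\<close>

lemma restricted_Suc:
  "restricted m (Suc n) X Y = shift ` restricted m n Y {} \<union>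
     (\<Union>a\<in>{..<m} - X. (\<lambda>D. insert (1, a) (shift D)) ` restricted m n (insert a Y) {a})"
proof (intro equalityI subsetI)
  fix D assume D: "D \<in> restricted m (Suc n) X Y"
  \<comment> \<open>\<open>D\<close> without its first position, moved back by one. The condition
    \<open>i \<noteq> 0\<close> is what drops the dimer at position 1.\<close>
  define E where "E = {(i, a). i \<noteq> 0 \<and> (Suc i, a) \<in> D}"
  have no0: "(0, b) \<notin> E" for b by (simp add: E_def)
  have E: "shift E = {(i, b). (i, b) \<in> D \<and> i \<noteq> 1}"
  proof (rule set_eqI, clarify)
    fix i b
    have "i = 0 \<Longrightarrow> (i, b) \<notin> D" using restricted_no_0[OF D] by simp
    then show "(i, b) \<in> shift E \<longleftrightarrow> (i, b) \<in> {(i, b). (i, b) \<in> D \<and> i \<noteq> 1}"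
      by (cases i) (auto simp: E_def)
  qed
  show "D \<in> shift ` restricted m n Y {} \<union>
     (\<Union>a\<in>{..<m} - X. (\<lambda>D. insert (1, a) (shift D)) ` restricted m n (insert a Y) {a})"
  proof (cases "\<exists>a. (1, a) \<in> D")
    case True
    then obtain a where a: "(1, a) \<in> D" by blast
    have "valid D" using D by (simp add: restricted_def)
    then have "(1, b) \<in> D \<longleftrightarrow> b = a" for b using a unfolding valid_def by blast
    then have eq: "D = insert (1, a) (shift E)" unfolding E by auto
    then have "a \<in> {..<m} - X \<and> E \<in> restricted m n (insert a Y) {a}"
      using D insert_shift_mem_restricted[OF no0] by simp
    with eq show ?thesis by blast
  next
    case False
    then have eq: "D = shift E" unfolding E by auto
    then have "E \<in> restricted m n Y {}" using D shift_mem_restricted[OF no0] by simp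
    with eq show ?thesis by blast
  qed
next
  fix D
  assume "D \<in> shift ` restricted m n Y {} \<union>
     (\<Union>a\<in>{..<m} - X. (\<lambda>D. insert (1, a) (shift D)) ` restricted m n (insert a Y) {a})"
  then consider E where "D = shift E" "E \<in> restricted m n Y {}"
    | a E where "a \<in> {..<m} - X" "D = insert (1, a) (shift E)"
        "E \<in> restricted m n (insert a Y) {a}"
    by blast
  then show "D \<in> restricted m (Suc n) X Y"
  proof cases
    case 1
    then show ?thesis using shift_mem_restricted restricted_no_0 by metis
  next
    case 2
    then show ?thesis using insert_shift_mem_restricted restricted_no_0 by metis
  qed
qed

section \<open>Weights under the shift\<close>

definition weight :: "'a::comm_ring_1 \<Rightarrow> 'a \<Rightarrow> dimer set \<Rightarrow> 'a" where
  "weight r s D = r ^ card D * s ^ (\<Sum>d\<in>D. fst d)"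

lemma inj_on_shift: "inj_on (map_prod Suc id) (D :: dimer set)"
  by (auto simp: inj_on_def)

text \<open>Each dimer moves by one position, so the exponent of \<open>s\<close> grows by the
  number of dimers and the extra factor is absorbed into \<open>r\<close>.\<close>

lemma weight_shift:
  assumes "finite D"
  shows "weight r s (shift D) = weight (r * s) s D"
proof -
  have "card (shift D) = card D" unfolding shift_def by (rule card_image[OF inj_on_shift])
  moreover have "(\<Sum>d\<in>shift D. fst d) = (\<Sum>d\<in>D. fst d) + card D"
    unfolding shift_def sum.reindex[OF inj_on_shift] by (simp add: sum_Suc)
  ultimately show ?thesis by (simp add: weight_def power_add power_mult_distrib ac_simps)
qed

lemma weight_insert_shift:
  assumes "finite D" "(0, a) \<notin> D"
  shows "weight r s (insert (1, a) (shift D)) = r * s * weight (r * s) s D"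
proof -
  have "finite (shift D)" "(1, a) \<notin> shift D" using assms by (auto simp: shift_def)
  then have "weight r s (insert (1, a) (shift D)) = r * s * weight r s (shift D)"
    by (simp add: weight_def ac_simps)
  then show ?thesis using weight_shift[OF assms(1)] by metis
qed

section \<open>Generating functions of the states\<close>

definition gf :: "nat \<Rightarrow> nat \<Rightarrow> nat set \<Rightarrow> nat set \<Rightarrow> 'a::comm_ring_1 \<Rightarrow> 'a \<Rightarrow> 'a" where
  "gf m n X Y r s = (\<Sum>D\<in>restricted m n X Y. weight r s D)"

lemma G2_eq_gf: "G2 n m r s = gf m (nat n) {} {} r s"
  by (simp add: G2_def gf_def weight_def configs_def restricted_def valid_iff dimers_def)

lemma gf_0: "gf m 0 X Y r s = 1"
proof -
  have "restricted m 0 X Y = {{}}" by (auto simp: restricted_def dimers_def valid_def)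
  then show ?thesis by (simp add: gf_def weight_def)
qed

lemma gf_Suc:
  "gf m (Suc n) X Y r s = gf m n Y {} (r * s) s +
     r * s * (\<Sum>a\<in>{..<m} - X. gf m n (insert a Y) {a} (r * s) s)"
proof -
  let ?A = "shift ` restricted m n Y {}"
  let ?i = "\<lambda>a D. insert (1, a) (shift D)"
  let ?B = "\<lambda>a. ?i a ` restricted m n (insert a Y) {a}"
  have one: "(1, b) \<notin> shift D" if "D \<in> restricted m n Z W" for D Z W b
    using restricted_no_0[OF that] by auto
  \<comment> \<open>The color at position 1 can be read off from the configuration, so the pieces of
    the decomposition are disjoint.\<close>
  have mem1: "(1, b) \<in> D \<longleftrightarrow> b = a" if "D \<in> ?B a" for a b D
    using that one by auto
  have disj: "?A \<inter> (\<Union>a\<in>{..<m} - X. ?B a) = {}"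
    using mem1 one by blast
  have inj: "inj_on (?i a) (restricted m n (insert a Y) {a})" for a
    \<comment> \<open>Position 1 of \<open>shift D\<close> is free, so the inserted dimer can be
      cancelled.\<close>
    using one by (intro inj_onI) (metis insert_ident shift_inject)
  have "gf m (Suc n) X Y r s = sum (weight r s) ?A + sum (weight r s) (\<Union>a\<in>{..<m} - X. ?B a)"
    unfolding gf_def restricted_Suc
    by (rule sum.union_disjoint) (use disj finite_restricted in auto)
  also have "sum (weight r s) (\<Union>a\<in>{..<m} - X. ?B a) = (\<Sum>a\<in>{..<m} - X. sum (weight r s) (?B a))"
  proof (rule sum.UNION_disjoint)
    show "\<forall>a\<in>{..<m} - X. \<forall>b\<in>{..<m} - X. a \<noteq> b \<longrightarrow> ?B a \<inter> ?B b = {}"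
      using mem1 by blast
  qed (auto simp: finite_restricted)
  also have "sum (weight r s) ?A = gf m n Y {} (r * s) s"
    unfolding gf_def
    by (subst sum.reindex) (auto simp: inj_on_def shift_inject intro!: sum.cong
        weight_shift dest: restricted_finite)
  finally have split: "gf m (Suc n) X Y r s =
      gf m n Y {} (r * s) s + (\<Sum>a\<in>{..<m} - X. sum (weight r s) (?B a))" .
  have "sum (weight r s) (?B a) = r * s * gf m n (insert a Y) {a} (r * s) s" for a
    unfolding gf_def sum.reindex[OF inj] o_def sum_distrib_left
    by (intro sum.cong refl weight_insert_shift) (auto dest: restricted_finite restricted_no_0)
  then show ?thesis by (simp add: split sum_distrib_left)
qed

section \<open>The linear system for the four states and its elimination\<close>

text \<open>
  The four states are: no color forbidden, one color forbidden at both positions, one color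
  forbidden at the first position only, and two colors forbidden at the first position and one of
  them also at the second. The last factor \<open>M - 2\<close> is meaningful only if there are two colors,
  which is why the system is stated for a ring element \<open>M\<close> instead of the number \<open>m\<close>.
\<close>

fun free_gf both_gf first_gf two_gf :: "'a::comm_ring_1 \<Rightarrow> nat \<Rightarrow> 'a \<Rightarrow> 'a \<Rightarrow> 'a" where
  "free_gf M 0 r s = 1"
| "free_gf M (Suc n) r s = free_gf M n (r * s) s + r * s * (M * both_gf M n (r * s) s)"
| "both_gf M 0 r s = 1"
| "both_gf M (Suc n) r s = first_gf M n (r * s) s + r * s * ((M - 1) * two_gf M n (r * s) s)"
| "first_gf M 0 r s = 1"
| "first_gf M (Suc n) r s = free_gf M n (r * s) s + r * s * ((M - 1) * both_gf M n (r * s) s)"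
| "two_gf M 0 r s = 1"
| "two_gf M (Suc n) r s = first_gf M n (r * s) s + r * s * ((M - 2) * two_gf M n (r * s) s)"

lemma of_nat_card_remove1:
  assumes "a < m"
  shows "of_nat (card ({..<m} - {a})) = (of_nat m - 1 :: 'a::comm_ring_1)"
  using assms by (simp add: of_nat_diff)

text \<open>Two distinct colors below \<open>m\<close> force \<open>2 \<le> m\<close>, so truncated
  subtraction agrees with that of the ring.\<close>

lemma of_nat_card_remove2:
  assumes "a < m" "b < m" "a \<noteq> b"
  shows "of_nat (card ({..<m} - {a, b})) = (of_nat m - 2 :: 'a::comm_ring_1)"
proof -
  have "card ({..<m} - {a, b}) = m - 2" using assms by (subst card_Diff_subset) auto
  moreover have "2 \<le> m" using assms by linarith
  ultimately show ?thesis by (simp add: of_nat_diff)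
qed

text \<open>The values depend only on how the forbidden colors overlap, so each sum in
  \<open>gf_Suc\<close> is a number of choices times a common value. The claims refer to each other
  and need one joint induction, with colors and \<open>r\<close> arbitrary since both change. If
  there are too few colors for a state, a factor \<open>M\<close> or \<open>M - 1\<close> equal to 0
  cuts it off from \<open>free_gf\<close>.\<close>

lemma gf_eq:
  fixes r s :: "'a::comm_ring_1"
  shows "gf m n {} {} r s = free_gf (of_nat m) n r s"
    and "a < m \<Longrightarrow> gf m n {a} {a} r s = both_gf (of_nat m) n r s"
    and "a < m \<Longrightarrow> gf m n {a} {} r s = first_gf (of_nat m) n r s"
    and "a < m \<Longrightarrow> b < m \<Longrightarrow> a \<noteq> b \<Longrightarrow> gf m n {a, b} {a} r s = two_gf (of_nat m) n r s"
proof (induction n arbitrary: a b r)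
  case 0
  { case 1 show ?case by (simp add: gf_0) }
  { case 2 show ?case by (simp add: gf_0) }
  { case 3 show ?case by (simp add: gf_0) }
  { case 4 show ?case by (simp add: gf_0) }
next
  case (Suc n)
  { case 1 show ?case by (simp add: gf_Suc Suc.IH) }
  { case 2
    have "(\<Sum>b\<in>{..<m} - {a}. gf m n {b, a} {b} (r * s) s) =
        (\<Sum>b\<in>{..<m} - {a}. two_gf (of_nat m) n (r * s) s)"
      using 2 by (intro sum.cong refl Suc.IH(4)) auto
    then show ?case using 2 by (simp add: gf_Suc Suc.IH(3) of_nat_card_remove1 del: card_Diff_insert) }
  { case 3
    have "(\<Sum>b\<in>{..<m} - {a}. gf m n {b} {b} (r * s) s) =
        (\<Sum>b\<in>{..<m} - {a}. both_gf (of_nat m) n (r * s) s)"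
      by (intro sum.cong refl Suc.IH(2)) auto
    then show ?case using 3 by (simp add: gf_Suc Suc.IH(1) of_nat_card_remove1 del: card_Diff_insert) }
  { case 4
    have "(\<Sum>c\<in>{..<m} - {a, b}. gf m n {c, a} {c} (r * s) s) =
        (\<Sum>c\<in>{..<m} - {a, b}. two_gf (of_nat m) n (r * s) s)"
      using 4 by (intro sum.cong refl Suc.IH(4)) auto
    then show ?case using 4
      by (simp add: gf_Suc Suc.IH(3) of_nat_card_remove2 del: card_Diff_insert) }
qed

text \<open>No induction: for \<open>n = k + 4\<close> both sides unfold to combinations of the four
  state values at \<open>k\<close> and \<open>r * s ^ 4\<close>, and the coefficients agree. For
  \<open>n = 2\<close> and \<open>n = 3\<close> truncated indices become 0, where the value is
  1.\<close>

lemma free_gf_recurrence: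
  fixes M r s :: "'a::comm_ring_1"
  assumes "n \<ge> 2"
  shows "free_gf M n r s =
    (1 + r * s * (M - 2)) * free_gf M (n - 1) (r * s) s
    + r * s * free_gf M (n - 2) (r * s ^ 2) s
    + r * s * (1 + r * s ^ 2 * (M - 1)) * free_gf M (n - 3) (r * s ^ 3) s
    + r ^ 2 * s ^ 3 * free_gf M (n - 4) (r * s ^ 4) s"
proof -
  \<comment> \<open>Brings the arguments into the shape \<open>r * s * s\<close> that unfolding
    produces.\<close>
  have pow: "r * s ^ 2 = r * s * s" "r * s ^ 3 = r * s * s * s" "r * s ^ 4 = r * s * s * s * s"
    by (simp_all add: eval_nat_numeral ac_simps)
  consider "n = 2" | "n = 3" | k where "n = Suc (Suc (Suc (Suc k)))"
    using assms by (metis le_Suc_ex not0_implies_Suc numeral_2_eq_2 numeral_3_eq_3 plus_nat.simps)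
  then show ?thesis
  proof cases
    case 1
    then show ?thesis unfolding pow by (simp add: eval_nat_numeral algebra_simps)
  next
    case 2
    then show ?thesis unfolding pow by (simp add: eval_nat_numeral algebra_simps)
  next
    case 3
    then show ?thesis unfolding pow by (simp add: eval_nat_numeral algebra_simps)
  qed
qed

theorem proposition3p9:
  fixes m :: nat and r s :: "'a::comm_ring_1"
  shows "(\<forall>n::int. n \<ge> 2 \<longrightarrow>
            G2 n m r s =
              (1 + r * s * (of_nat m - 2)) * G2 (n - 1) m (r * s) s
              + r * s * G2 (n - 2) m (r * s ^ 2) s
              + r * s * (1 + r * s ^ 2 * (of_nat m - 1)) * G2 (n - 3) m (r * s ^ 3) s
              + r ^ 2 * s ^ 3 * G2 (n - 4) m (r * s ^ 4) s)
         \<and> (\<forall>i::int. i \<le> 0 \<longrightarrow> G2 i m r s = 1)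
         \<and> G2 1 m r s = 1 + r * s * of_nat m"
proof (intro conjI allI impI)
  fix n :: int assume "n \<ge> 2"
  then have "nat n \<ge> 2" by simp
  \<comment> \<open>Truncation matches \<open>nat\<close> of a negative integer: both give 0, in
    accordance with the convention for indices below 0.\<close>
  have "nat n - k = nat (n - int k)" for k by linarith
  from this[of 1] this[of 2] this[of 3] this[of 4] free_gf_recurrence[OF \<open>nat n \<ge> 2\<close>, of "of_nat m" r s]
  show "G2 n m r s =
              (1 + r * s * (of_nat m - 2)) * G2 (n - 1) m (r * s) s
              + r * s * G2 (n - 2) m (r * s ^ 2) s
              + r * s * (1 + r * s ^ 2 * (of_nat m - 1)) * G2 (n - 3) m (r * s ^ 3) s
              + r ^ 2 * s ^ 3 * G2 (n - 4) m (r * s ^ 4) s"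
    by (simp add: G2_eq_gf gf_eq(1))
qed (simp_all add: G2_eq_gf gf_eq(1))

end
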